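(* For every integer $n \ge 5$, $\mathrm{eqdim}(K_{n,2}) = 3$.
   Context: For positive integers $n$ and $k$, the Kneser graph $K_{n,k}$ has as vertices all $k$-element subsets of $\{1,\dots,n\}$, two such subsets $A,B$ being adjacent iff $A \cap B = \emptyset$. In a connected graph $G$, $d(u,v)$ is the shortest-path distance. A subset $S \subseteq V(G)$ is a distance-equalizer set of $G$ if for every two distinct vertices $u,v \in V(G)\setminus S$ there exists $x \in S$ with $d(u,x) = d(v,x)$. The equidistant dimension $\mathrm{eqdim}(G)$ is the minimum cardinality of a distance-equalizer set of $G$. *)

theory Defs
  imports "Graph_Theory.Graph_Theory"
begin

text \<open>Undirected graphs are rendered as symmetric digraphs: an edge \<open>{u, v}\<close> is the pair of
  opposite arcs \<open>(u, v)\<close> and \<open>(v, u)\<close>.\<close>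

definition kneser_graph :: "nat \<Rightarrow> nat \<Rightarrow> nat set pair_pre_digraph" where
  "kneser_graph n k =
     \<lparr> pverts = {A. A \<subseteq> {1..n} \<and> card A = k},
       parcs = {(A, B). A \<subseteq> {1..n} \<and> card A = k \<and> B \<subseteq> {1..n} \<and> card B = k \<and> A \<inter> B = {}} \<rparr>"

lemma pair_graph_kneser_graph:
  assumes "k > 0"
  shows "pair_graph (kneser_graph n k)"
proof (intro_locales; unfold_locales)
  let ?K = "kneser_graph n k"
  show fin: "finite (pverts ?K)"
    by (simp add: kneser_graph_def)
  have "parcs ?K \<subseteq> pverts ?K \<times> pverts ?K"
    by (auto simp: kneser_graph_def)
  then show "finite (parcs ?K)"
    by (rule finite_subset) (use fin in simp)
  show "fst e \<in> pverts ?K" "snd e \<in> pverts ?K" if "e \<in> parcs ?K" for e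
    using that by (auto simp: kneser_graph_def)
  show "fst e \<noteq> snd e" if "e \<in> parcs ?K" for e
  proof
    assume eq: "fst e = snd e"
    have "fst e \<inter> snd e = {}" and "card (fst e) = k"
      using that unfolding kneser_graph_def by auto
    then have "fst e = {}" and "card (fst e) = k"
      unfolding eq Int_absorb by simp_all
    with assms show False by (metis card.empty less_irrefl)
  qed
  show "symmetric (with_proj ?K)"
    unfolding symmetric_def with_proj_simps by (rule symI) (auto simp: kneser_graph_def)
qed

text \<open>Shortest-path distance: the cost of an arc walk under unit weights is its length. Vertices in
  different components are at distance \<open>\<infinity>\<close>.\<close>

definition graph_dist :: "('a, 'b) pre_digraph \<Rightarrow> 'a \<Rightarrow> 'a \<Rightarrow> ereal" where
  "graph_dist G u v = wf_digraph.\<mu> G (\<lambda>_. 1) u v"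

definition distance_equalizer_set :: "('a, 'b) pre_digraph \<Rightarrow> 'a set \<Rightarrow> bool" where
  "distance_equalizer_set G S \<longleftrightarrow>
     S \<subseteq> verts G \<and>
     (\<forall>u \<in> verts G - S. \<forall>v \<in> verts G - S. u \<noteq> v \<longrightarrow>
        (\<exists>x \<in> S. graph_dist G u x = graph_dist G v x))"

definition eqdim :: "('a, 'b) pre_digraph \<Rightarrow> nat" where
  "eqdim G = (LEAST m. \<exists>S. distance_equalizer_set G S \<and> finite S \<and> card S = m)"

end

theory Submission
  imports Defs
begin

text \<open>For \<open>n \<ge> 5\<close>, distinct vertices of \<open>K(n, 2)\<close> are at distance 1 if they are disjoint and 2 if they
  meet, so \<open>x\<close> equalizes \<open>u\<close> and \<open>v\<close> iff both or neither of them meet \<open>x\<close>. A vertex outside the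
  triangle \<open>12, 13, 23\<close> meets either none or exactly two of its edges; such patterns always agree
  somewhere, so the triangle is an equalizer set. Two vertices never suffice: for \<open>ab, ac\<close> the
  pair \<open>ad, de\<close> is not equalized, and for disjoint \<open>ab, cd\<close> the pair \<open>ae, ce\<close> is not.\<close>

text \<open>Unit weights make the cost of a walk its length. A distance is then computed by one
  explicit walk from above and a length bound for all walks from below.\<close>

lemma graph_dist_eq_INF_length:
  assumes "wf_digraph G"
  shows "graph_dist G u v = (INF p \<in> {p. pre_digraph.awalk G u p v}. ereal (real (length p)))"
proof -
  interpret wf_digraph G by fact
  have "awalk_cost (\<lambda>_. 1) p = real (length p)" for p :: "'b list"
    by (induction p) auto
  then show ?thesis
    by (simp add: graph_dist_def \<mu>_def)
qed

lemma graph_dist_dominates: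
  assumes "wf_digraph G" and "u \<rightarrow>\<^bsub>G\<^esub> v" and "u \<noteq> v"
  shows "graph_dist G u v = 1"
proof -
  interpret wf_digraph G by fact
  obtain e where e: "e \<in> arcs G" "tail G e = u" "head G e = v"
    using assms(2) by (auto simp: arcs_ends_def arc_to_ends_def)
  have "awalk u [e] v"
    using e by (auto simp: awalk_simps)
  moreover have "1 \<le> length p" if "awalk u p v" for p
    using that \<open>u \<noteq> v\<close> by (cases p) (auto simp: awalk_simps)
  ultimately show ?thesis
    unfolding graph_dist_eq_INF_length[OF assms(1)]
    by (intro antisym INF_lower2[of "[e]"] INF_greatest) (auto simp: one_ereal_def)
qed

text \<open>The walk through \<open>w\<close> gives the upper bound. A shorter walk is empty,
  forcing \<open>u = v\<close>, or a single arc, forcing adjacency.\<close>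

lemma graph_dist_common_neighbour:
  assumes "wf_digraph G" and "u \<rightarrow>\<^bsub>G\<^esub> w" and "w \<rightarrow>\<^bsub>G\<^esub> v" and "u \<noteq> v" and "\<not> u \<rightarrow>\<^bsub>G\<^esub> v"
  shows "graph_dist G u v = 2"
proof -
  interpret wf_digraph G by fact
  obtain e f where e: "e \<in> arcs G" "tail G e = u" "head G e = w"
    and f: "f \<in> arcs G" "tail G f = w" "head G f = v"
    using assms(2,3) by (auto simp: arcs_ends_def arc_to_ends_def)
  have "awalk u [e, f] v"
    using e f by (auto simp: awalk_simps)
  moreover have "2 \<le> length p" if p: "awalk u p v" for p
  proof (rule ccontr)
    assume "\<not> 2 \<le> length p"
    then consider "p = []" | g where "p = [g]"
      by (cases p; cases "tl p") auto
    then show False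
      using p \<open>u \<noteq> v\<close> \<open>\<not> u \<rightarrow>\<^bsub>G\<^esub> v\<close>
      by cases (auto simp: awalk_simps arcs_ends_def arc_to_ends_def)
  qed
  ultimately show ?thesis
    unfolding graph_dist_eq_INF_length[OF assms(1)]
    by (intro antisym INF_lower2[of "[e, f]"] INF_greatest) auto
qed

text \<open>Enlarging the set leaves fewer pairs to equalize and keeps the old witnesses.\<close>

lemma distance_equalizer_set_mono:
  assumes "distance_equalizer_set G S" and "S \<subseteq> T" and "T \<subseteq> verts G"
  shows "distance_equalizer_set G T"
  using assms unfolding distance_equalizer_set_def by blast

lemma graph_dist_kneser_2:
  assumes "n \<ge> 5" and A: "A \<in> pverts (kneser_graph n 2)" and B: "B \<in> pverts (kneser_graph n 2)"
    and "A \<noteq> B"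
  shows "graph_dist (with_proj (kneser_graph n 2)) A B = (if A \<inter> B = {} then 1 else 2)"
proof -
  let ?K = "with_proj (kneser_graph n 2)"
  interpret pair_graph "kneser_graph n 2"
    by (rule pair_graph_kneser_graph) simp
  have wf: "wf_digraph ?K" ..
  have adj: "(X, Y) \<in> parcs (kneser_graph n 2) \<longleftrightarrow>
      X \<in> pverts (kneser_graph n 2) \<and> Y \<in> pverts (kneser_graph n 2) \<and> X \<inter> Y = {}" for X Y
    by (auto simp: kneser_graph_def)
  show ?thesis
  proof (cases "A \<inter> B = {}")
    case True
    then show ?thesis
      using graph_dist_dominates[OF wf _ \<open>A \<noteq> B\<close>] A B by (simp add: adj)
  next
    case False
    have AB: "A \<subseteq> {1..n}" "B \<subseteq> {1..n}" "card A = 2" "card B = 2"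
      using A B by (auto simp: kneser_graph_def)
    then have fin: "finite A" "finite B"
      by (auto intro: finite_subset)
    then have "card (A \<inter> B) \<ge> 1"
      using False by (simp add: Suc_le_eq card_gt_0_iff)
    \<comment> \<open>Two meeting pairs cover at most three points, so at least two points remain;
      these form a common neighbour \<open>C\<close>.\<close>
    then have "card (A \<union> B) \<le> 3"
      using card_Un_Int[OF fin] AB by simp
    then have "card ({1..n} - (A \<union> B)) \<ge> 2"
      using AB fin \<open>n \<ge> 5\<close> by (subst card_Diff_subset) auto
    then obtain C where C: "C \<subseteq> {1..n} - (A \<union> B)" "card C = 2"
      by (meson obtain_subset_with_card_n)
    then have "C \<in> pverts (kneser_graph n 2)" "A \<inter> C = {}" "C \<inter> B = {}"
      by (auto simp: kneser_graph_def)
    then show ?thesis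
      using graph_dist_common_neighbour[OF wf, of A C B] False A B \<open>A \<noteq> B\<close> by (simp add: adj)
  qed
qed

text \<open>Members of \<open>S\<close> differ from \<open>u\<close> and \<open>v\<close>, so
  distance 0 never occurs and only the values 1 and 2 are compared. This removes distances from the
  rest of the argument.\<close>

lemma distance_equalizer_set_kneser_2:
  assumes "n \<ge> 5"
  shows "distance_equalizer_set (with_proj (kneser_graph n 2)) S \<longleftrightarrow>
    S \<subseteq> pverts (kneser_graph n 2) \<and>
    (\<forall>u \<in> pverts (kneser_graph n 2) - S. \<forall>v \<in> pverts (kneser_graph n 2) - S. u \<noteq> v \<longrightarrow>
       (\<exists>x \<in> S. u \<inter> x = {} \<longleftrightarrow> v \<inter> x = {}))"
proof (cases "S \<subseteq> pverts (kneser_graph n 2)")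
  case True
  have "graph_dist (with_proj (kneser_graph n 2)) u x = graph_dist (with_proj (kneser_graph n 2)) v x
      \<longleftrightarrow> (u \<inter> x = {} \<longleftrightarrow> v \<inter> x = {})"
    if "u \<in> pverts (kneser_graph n 2) - S" "v \<in> pverts (kneser_graph n 2) - S" "x \<in> S" for u v x
  proof -
    have "x \<in> pverts (kneser_graph n 2)" "u \<noteq> x" "v \<noteq> x"
      using that True by auto
    then show ?thesis
      using that by (simp add: graph_dist_kneser_2[OF assms])
  qed
  with True show ?thesis
    by (simp add: distance_equalizer_set_def)
next
  case False
  then show ?thesis
    by (auto simp: distance_equalizer_set_def)
qed

lemma two_subset_in_pverts_kneser_2:
  assumes "a \<in> {1..n}" and "b \<in> {1..n}" and "a \<noteq> b"
  shows "{a, b} \<in> pverts (kneser_graph n 2)"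
  using assms by (auto simp: kneser_graph_def)

lemma pverts_kneser_2_eqI:
  assumes "A \<in> pverts (kneser_graph n 2)" and "a \<in> A" and "b \<in> A" and "a \<noteq> b"
  shows "A = {a, b}"
proof -
  have "card A = 2" "finite A"
    using assms(1) by (auto simp: kneser_graph_def intro: finite_subset)
  then show ?thesis
    using assms card_subset_eq[of A "{a, b}"] by simp
qed

lemma pverts_kneser_2_memE:
  assumes "A \<in> pverts (kneser_graph n 2)" and "a \<in> A"
  obtains b where "A = {a, b}" "a \<noteq> b" "a \<in> {1..n}"
proof -
  have A: "card A = 2" "A \<subseteq> {1..n}"
    using assms(1) by (auto simp: kneser_graph_def)
  then have "A \<noteq> {a}"
    by auto
  then obtain b where "b \<in> A" "a \<noteq> b"
    using assms(2) by blast
  with A assms show thesis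
    using pverts_kneser_2_eqI that by blast
qed

lemma disjoint_pair_iff: "A \<inter> {a, b} = {} \<longleftrightarrow> a \<notin> A \<and> b \<notin> A"
  by auto

lemma triangle_distance_equalizer_set:
  assumes "n \<ge> 5"
  shows "distance_equalizer_set (with_proj (kneser_graph n 2)) {{1, 2}, {1, 3}, {2, 3}}"
proof -
  have "{{1, 2}, {1, 3}, {2, 3}} \<subseteq> pverts (kneser_graph n 2)"
    using assms by (simp add: two_subset_in_pverts_kneser_2)
  moreover have "\<exists>x \<in> {{1, 2}, {1, 3}, {2, 3 :: nat}}. u \<inter> x = {} \<longleftrightarrow> v \<inter> x = {}"
    if uv: "u \<in> pverts (kneser_graph n 2) - {{1, 2}, {1, 3}, {2, 3}}"
      "v \<in> pverts (kneser_graph n 2) - {{1, 2}, {1, 3}, {2, 3}}" for u v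
  proof -
    \<comment> \<open>A 2-set containing two of the points 1, 2, 3 would itself be an edge of the
      triangle.\<close>
    have at_most_one: "\<not> (1 \<in> w \<and> 2 \<in> w)" "\<not> (1 \<in> w \<and> 3 \<in> w)" "\<not> (2 \<in> w \<and> 3 \<in> w)"
      if "w \<in> pverts (kneser_graph n 2) - {{1, 2}, {1, 3}, {2, 3}}" for w
      using that pverts_kneser_2_eqI[of w n 1 2] pverts_kneser_2_eqI[of w n 1 3]
        pverts_kneser_2_eqI[of w n 2 3] by (simp_all, blast+)
    show ?thesis
      \<comment> \<open>What remains is propositional in six atoms: membership of 1, 2, 3 in
        \<open>u\<close> and in \<open>v\<close>.\<close>
      using at_most_one[OF uv(1)] at_most_one[OF uv(2)]
      unfolding bex_simps disjoint_pair_iff by argo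
  qed
  ultimately show ?thesis
    unfolding distance_equalizer_set_kneser_2[OF assms] by simp
qed

lemma two_vertices_not_distance_equalizer_set:
  assumes "n \<ge> 5" and "x \<noteq> y"
  shows "\<not> distance_equalizer_set (with_proj (kneser_graph n 2)) {x, y}"
proof
  let ?V = "pverts (kneser_graph n 2)"
  assume eq: "distance_equalizer_set (with_proj (kneser_graph n 2)) {x, y}"
  then have V: "x \<in> ?V" "y \<in> ?V"
    by (auto simp: distance_equalizer_set_def)
  have eqD: "(u \<inter> x = {} \<longleftrightarrow> v \<inter> x = {}) \<or> (u \<inter> y = {} \<longleftrightarrow> v \<inter> y = {})"
    if "u \<in> ?V" "v \<in> ?V" "u \<noteq> v" "u \<notin> {x, y}" "v \<notin> {x, y}" for u v
    using eq that unfolding distance_equalizer_set_kneser_2[OF \<open>n \<ge> 5\<close>] by auto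
  \<comment> \<open>Source of fresh points: below, \<open>F\<close> lists at most four points, and
    \<open>n \<ge> 5\<close>.\<close>
  have new: "\<exists>e \<in> {1..n}. e \<notin> F" if "finite F" "card F < n" for F
    using card_mono[of F "{1..n}"] that by fastforce
  show False
  proof (cases "x \<inter> y = {}")
    case True
    have "x \<noteq> {}" "y \<noteq> {}"
      using V by (auto simp: kneser_graph_def)
    then obtain a b c d where xy: "x = {a, b}" "y = {c, d}" and ac: "a \<in> {1..n}" "c \<in> {1..n}"
      by (metis V equals0I pverts_kneser_2_memE)
    have neq: "a \<noteq> c" "a \<noteq> d" "b \<noteq> c"
      using True xy by auto
    have "card {a, b, c, d} < n"
      using \<open>n \<ge> 5\<close> by (simp add: card_insert_if)
    then obtain e where e: "e \<in> {1..n}" "e \<notin> {a, b, c, d}"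
      using new[of "{a, b, c, d}"] by blast
    have "{a, e} \<in> ?V" "{c, e} \<in> ?V"
      using ac e by (auto intro!: two_subset_in_pverts_kneser_2)
    moreover have "{a, e} \<noteq> {c, e}" "{a, e} \<notin> {x, y}" "{c, e} \<notin> {x, y}"
      using xy e neq by (simp_all add: doubleton_eq_iff)
    \<comment> \<open>\<open>{a, e}\<close> meets \<open>x\<close> but not \<open>y\<close>, while
      \<open>{c, e}\<close> meets \<open>y\<close> but not \<open>x\<close>.\<close>
    ultimately show False
      using eqD[of "{a, e}" "{c, e}"] xy e neq by (simp add: disjoint_pair_iff)
  next
    case False
    then obtain a where "a \<in> x" "a \<in> y"
      by blast
    then obtain b c where xy: "x = {a, b}" "y = {a, c}" and a: "a \<in> {1..n}"
      by (metis V pverts_kneser_2_memE)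
    have "card {a, b, c} < n"
      using \<open>n \<ge> 5\<close> by (simp add: card_insert_if)
    then obtain d where d: "d \<in> {1..n}" "d \<notin> {a, b, c}"
      using new[of "{a, b, c}"] by blast
    have "card {a, b, c, d} < n"
      using \<open>n \<ge> 5\<close> by (simp add: card_insert_if)
    then obtain e where e: "e \<in> {1..n}" "e \<notin> {a, b, c, d}"
      using new[of "{a, b, c, d}"] by blast
    have "{a, d} \<in> ?V" "{d, e} \<in> ?V"
      using a d e by (auto intro!: two_subset_in_pverts_kneser_2)
    moreover have "{a, d} \<noteq> {d, e}" "{a, d} \<notin> {x, y}" "{d, e} \<notin> {x, y}"
      using xy d e by (simp_all add: doubleton_eq_iff)
    \<comment> \<open>\<open>{a, d}\<close> meets both \<open>x\<close> and \<open>y\<close> in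
      \<open>a\<close>, while \<open>{d, e}\<close> meets neither.\<close>
    ultimately show False
      using eqD[of "{a, d}" "{d, e}"] xy d e by (simp add: disjoint_pair_iff)
  qed
qed

text \<open>By monotonicity a smaller equalizer set could be padded to exactly two vertices, which
  is already excluded.\<close>

lemma card_distance_equalizer_set_kneser_2_ge:
  assumes "n \<ge> 5" and S: "distance_equalizer_set (with_proj (kneser_graph n 2)) S"
  shows "3 \<le> card S"
proof (rule ccontr)
  let ?V = "pverts (kneser_graph n 2)"
  assume "\<not> 3 \<le> card S"
  have "S \<subseteq> ?V" "finite ?V"
    using S by (auto simp: distance_equalizer_set_def kneser_graph_def)
  \<comment> \<open>Two concrete vertices show that there is room for the padding.\<close>
  have "{{1, 2}, {1, 3}} \<subseteq> ?V"
    using \<open>n \<ge> 5\<close> by (simp add: two_subset_in_pverts_kneser_2)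
  moreover have "card {{1, 2}, {1, 3 :: nat}} = 2"
    by (simp add: card_2_iff doubleton_eq_iff)
  ultimately have "2 \<le> card ?V"
    using card_mono[OF \<open>finite ?V\<close>] by metis
  then obtain T where T: "S \<subseteq> T" "T \<subseteq> ?V" "card T = 2"
    using exists_subset_between[of S 2 ?V] \<open>\<not> 3 \<le> card S\<close> \<open>S \<subseteq> ?V\<close> \<open>finite ?V\<close> by auto
  then obtain x y where "T = {x, y}" "x \<noteq> y"
    by (auto simp: card_2_iff)
  then show False
    using two_vertices_not_distance_equalizer_set[OF \<open>n \<ge> 5\<close>]
      distance_equalizer_set_mono[OF S] T by auto
qed

theorem theorem6:
  fixes n :: nat
  assumes "n \<ge> 5"
  shows "eqdim (with_proj (kneser_graph n 2)) = 3"
  unfolding eqdim_def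
proof (rule Least_equality)
  have "card {{1, 2}, {1, 3}, {2, 3 :: nat}} = 3"
    by (simp add: card_insert_if doubleton_eq_iff)
  then show "\<exists>S. distance_equalizer_set (with_proj (kneser_graph n 2)) S \<and> finite S \<and> card S = 3"
    using triangle_distance_equalizer_set[OF assms] by (metis finite.emptyI finite_insert)
qed (use card_distance_equalizer_set_kneser_2_ge[OF assms] in blast)

end
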